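(* Let $0<L<\infty$, let $G,B\in\mathbb{R}$ be constants with $G^2+B^2\neq0$, and let $\tilde p,\tilde q\in C^0[0,L]$. Let $s_1,v_1,v_2$ be the functions on $[0,L]$ defined in the context. For each integer $n\geq 3$, consider (recursively in $n$, with $v_{n-2}$ and $v_{n-1}$ the functions already determined at lower orders) the linear problem on $[0,L]$ $$\frac{dv_n}{dx}=w_n,\qquad \frac{dw_n}{dx}=-3s_1(x)^2\,v_{n-2}(x)+\frac{G\tilde p(x)+B\tilde q(x)}{G^2+B^2}\,v_{n-1}(x),$$ with $v_n(0)=0$ and $w_n(L)=0$. Then for every $n=3,4,\ldots$ this problem has a unique solution $(v_n,w_n)^\top$, and $(v_n,w_n)^\top\in C^1([0,L];\mathbb{R}^2)$.
   Context: $C^r[0,L]$ denotes the space of $r$-times continuously differentiable real-valued functions on $[0,L]$; $C^0[0,L]$ is the space of continuous functions; $C^1([0,L];\mathbb{R}^2)$ is the space of $\mathbb{R}^2$-valued functions with both components in $C^1[0,L]$. The functions $s_1,v_1,v_2$ (together with auxiliary $w_1,w_2$) are the solutions on $[0,L]$ of $$\frac{ds_1}{dx}=\frac{B\tilde p(x)-G\tilde q(x)}{G^2+B^2},\quad s_1(L)=0;$$ $$\frac{dv_1}{dx}=w_1,\quad \frac{dw_1}{dx}=-\frac{G\tilde p(x)+B\tilde q(x)}{G^2+B^2},\quad v_1(0)=0,\ w_1(L)=0;$$ $$\frac{dv_2}{dx}=w_2,\quad \frac{dw_2}{dx}=s_1(x)^2+\frac{G\tilde p(x)+B\tilde q(x)}{G^2+B^2}\,v_1(x),\quad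 v_2(0)=0,\ w_2(L)=0.$$ *)

theory Defs
  imports "HOL-Analysis.Analysis"
begin

definition load :: "real \<Rightarrow> real \<Rightarrow> (real \<Rightarrow> real) \<Rightarrow> (real \<Rightarrow> real) \<Rightarrow> real \<Rightarrow> real" where
  "load G B p q x = (G * p x + B * q x) / (G\<^sup>2 + B\<^sup>2)"

(* Derivatives at the endpoints are one-sided. The library's C1_differentiable_on
   asks for two-sided derivatives at every point, so it does not describe C^1[0,L]. *)
definition C1_on_interval :: "real \<Rightarrow> (real \<Rightarrow> real) \<Rightarrow> bool" where
  "C1_on_interval L f \<longleftrightarrow>
     (\<exists>f'. (\<forall>x\<in>{0..L}. (f has_real_derivative f' x) (at x within {0..L})) \<and>
           continuous_on {0..L} f')"

definition is_bvp_solution ::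
    "real \<Rightarrow> (real \<Rightarrow> real) \<Rightarrow> (real \<Rightarrow> real) \<Rightarrow> (real \<Rightarrow> real) \<Rightarrow> bool" where
  "is_bvp_solution L f v w \<longleftrightarrow>
     (\<forall>x\<in>{0..L}. (v has_real_derivative w x) (at x within {0..L}) \<and>
                 (w has_real_derivative f x) (at x within {0..L})) \<and>
     v 0 = 0 \<and> w L = 0"

(* Functions with domain [0,L] are the extensional ones; this makes uniqueness
   of a solution mean equality on [0,L]. *)
definition bvp_solutions ::
    "real \<Rightarrow> (real \<Rightarrow> real) \<Rightarrow> ((real \<Rightarrow> real) \<times> (real \<Rightarrow> real)) set" where
  "bvp_solutions L f =
     {(v, w). v \<in> extensional {0..L} \<and> w \<in> extensional {0..L} \<and> is_bvp_solution L f v w}"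

definition order_rhs ::
    "(real \<Rightarrow> real) \<Rightarrow> (real \<Rightarrow> real) \<Rightarrow> (real \<Rightarrow> real) \<Rightarrow> (real \<Rightarrow> real) \<Rightarrow> real \<Rightarrow> real" where
  "order_rhs s1 g v'' v' x = - 3 * (s1 x)\<^sup>2 * v'' x + g x * v' x"

(* The functions v_n, with v_1 and v_2 given; the value at index 0 is never used.
   For n >= 3, v_n is the first component of the solution of the problem of order n. *)
fun v_seq ::
    "real \<Rightarrow> (real \<Rightarrow> real) \<Rightarrow> (real \<Rightarrow> real) \<Rightarrow> (real \<Rightarrow> real) \<Rightarrow> (real \<Rightarrow> real) \<Rightarrow>
     nat \<Rightarrow> real \<Rightarrow> real" where
  "v_seq L s1 g v1 v2 0 = (\<lambda>x. 0)"
| "v_seq L s1 g v1 v2 (Suc 0) = v1"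
| "v_seq L s1 g v1 v2 (Suc (Suc 0)) = v2"
| "v_seq L s1 g v1 v2 (Suc (Suc (Suc n))) =
     fst (THE vw. vw \<in> bvp_solutions L
       (order_rhs s1 g (v_seq L s1 g v1 v2 (Suc n)) (v_seq L s1 g v1 v2 (Suc (Suc n)))))"

end

(* The right-hand side of the problem of order n does not involve the unknowns, so the problem
   is solved by two integrations; solutions being continuous, so is the next right-hand side. *)
theory Submission
  imports Defs
begin

text \<open>The system \<open>v' = w\<close>, \<open>w' = f\<close> is triangular: \<open>w\<close>
  is the antiderivative of \<open>f\<close> that vanishes at \<open>L\<close>, and \<open>v\<close>
  is then the antiderivative of \<open>w\<close> that vanishes at 0. Each boundary condition fixes
  one constant of integration, so conditions at opposite ends do not conflict. For continuous
  \<open>f\<close> the fundamental theorem of calculus gives existence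
  (\<open>is_bvp_solution_exists\<close>); uniqueness (\<open>is_bvp_solution_unique\<close>) holds
  because antiderivatives on an interval differ by a constant. Continuity of the data passes from
  order to order (\<open>continuous_on_v_seq\<close>), so these facts apply at every order.\<close>

lemma eq_on_interval_if_same_derivative:
  fixes f g h :: "real \<Rightarrow> real"
  assumes f: "\<And>x. x \<in> {a..b} \<Longrightarrow> (f has_real_derivative h x) (at x within {a..b})"
    and g: "\<And>x. x \<in> {a..b} \<Longrightarrow> (g has_real_derivative h x) (at x within {a..b})"
    and c: "c \<in> {a..b}" "f c = g c" and x: "x \<in> {a..b}"
  shows "f x = g x"
proof -
  have "((\<lambda>x. f x - g x) has_real_derivative 0) (at x within {a..b})" if "x \<in> {a..b}" for x
    using DERIV_diff[OF f[OF that] g[OF that]] by simp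
  then obtain k where "\<And>x. x \<in> {a..b} \<Longrightarrow> f x - g x = k"
    using has_field_derivative_zero_constant[OF convex_real_interval(5)] by metis
  from this[OF c(1)] this[OF x] c(2) show ?thesis
    by simp
qed

lemma is_bvp_solution_continuous_on:
  assumes "is_bvp_solution L f v w"
  shows "continuous_on {0..L} v" "continuous_on {0..L} w"
  using assms unfolding is_bvp_solution_def
  by (blast intro: DERIV_continuous_on)+

lemma is_bvp_solution_unique:
  assumes "0 \<le> L" "is_bvp_solution L f v w" "is_bvp_solution L f v' w'" "x \<in> {0..L}"
  shows "v x = v' x \<and> w x = w' x"
proof -
  \<comment> \<open>\<open>w\<close> must be settled first: only then are \<open>v\<close> and
    \<open>v'\<close> known to have the same derivative. The points of agreement are
    \<open>L\<close> for \<open>w\<close> and 0 for \<open>v\<close>.\<close>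
  have w: "w y = w' y" if "y \<in> {0..L}" for y
    using assms(1-3) that unfolding is_bvp_solution_def
    by - (rule eq_on_interval_if_same_derivative[of 0 L w f w' L]; simp)
  have "v x = v' x"
    using assms w unfolding is_bvp_solution_def
    by - (rule eq_on_interval_if_same_derivative[of 0 L v w v' 0]; simp)
  with w assms(4) show ?thesis by blast
qed

text \<open>Derivatives within \<open>{0..L}\<close> see only the values there, so any solution
  yields an extensional one, as membership in \<open>bvp_solutions\<close> requires.\<close>

lemma is_bvp_solution_restrict:
  assumes "0 \<le> L" "is_bvp_solution L f v w"
  shows "is_bvp_solution L f (restrict v {0..L}) (restrict w {0..L})"
proof -
  have "(restrict u {0..L} has_real_derivative d) (at x within {0..L})"
    if "(u has_real_derivative d) (at x within {0..L})" "x \<in> {0..L}" for u x and d :: real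
    using that by (auto intro: has_field_derivative_transform_within[where d = 1])
  with assms show ?thesis
    unfolding is_bvp_solution_def by auto
qed

lemma is_bvp_solution_exists:
  assumes "0 \<le> L" "continuous_on {0..L} f"
  shows "\<exists>v w. is_bvp_solution L f v w"
proof -
  \<comment> \<open>The subtracted constant makes \<open>w L = 0\<close>; \<open>v 0 = 0\<close> is
    the integral over a single point.\<close>
  define w where "w x = integral {0..x} f - integral {0..L} f" for x
  define v where "v x = integral {0..x} w" for x
  have w: "(w has_real_derivative f x) (at x within {0..L})" if "x \<in> {0..L}" for x
    unfolding w_def using DERIV_diff[OF integral_has_real_derivative[OF assms(2) that] DERIV_const]
    by simp
  then have "continuous_on {0..L} w"
    by (rule DERIV_continuous_on)
  then have "(v has_real_derivative w x) (at x within {0..L})" if "x \<in> {0..L}" for x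
    unfolding v_def using that by (rule integral_has_real_derivative)
  with w have "is_bvp_solution L f v w"
    by (simp add: is_bvp_solution_def v_def w_def)
  then show ?thesis by blast
qed

lemma bvp_solutions_ex1:
  assumes "0 \<le> L" "continuous_on {0..L} f"
  shows "\<exists>!vw. vw \<in> bvp_solutions L f"
proof (rule ex_ex1I)
  obtain v w where "is_bvp_solution L f v w"
    using is_bvp_solution_exists[OF assms] by blast
  then have "(restrict v {0..L}, restrict w {0..L}) \<in> bvp_solutions L f"
    using is_bvp_solution_restrict[OF assms(1)] by (simp add: bvp_solutions_def)
  then show "\<exists>vw. vw \<in> bvp_solutions L f" by blast
next
  fix vw vw' assume "vw \<in> bvp_solutions L f" "vw' \<in> bvp_solutions L f"
  then obtain v w v' w' where vw: "vw = (v, w)" "vw' = (v', w')"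
    and ext: "v \<in> extensional {0..L}" "w \<in> extensional {0..L}"
      "v' \<in> extensional {0..L}" "w' \<in> extensional {0..L}"
    and sol: "is_bvp_solution L f v w" "is_bvp_solution L f v' w'"
    unfolding bvp_solutions_def by blast
  note eq = is_bvp_solution_unique[OF assms(1) sol]
  have "v = v'"
    using ext(1,3) conjunct1[OF eq] by (rule extensionalityI)
  moreover have "w = w'"
    using ext(2,4) conjunct2[OF eq] by (rule extensionalityI)
  ultimately show "vw = vw'"
    using vw by simp
qed

text \<open>The derivative of \<open>v\<close> is \<open>w\<close>, continuous because
  differentiable; that of \<open>w\<close> is \<open>f\<close>, continuous by assumption.\<close>

lemma bvp_solutions_C1:
  assumes "continuous_on {0..L} f" "(v, w) \<in> bvp_solutions L f"
  shows "C1_on_interval L v" "C1_on_interval L w"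
proof -
  have sol: "is_bvp_solution L f v w"
    using assms(2) by (simp add: bvp_solutions_def)
  then show "C1_on_interval L v"
    using is_bvp_solution_continuous_on(2)[OF sol]
    unfolding C1_on_interval_def is_bvp_solution_def by (intro exI[of _ w]) simp
  from sol assms(1) show "C1_on_interval L w"
    unfolding C1_on_interval_def is_bvp_solution_def by (intro exI[of _ f]) simp
qed

lemma continuous_on_order_rhs:
  assumes "continuous_on A s" "continuous_on A g" "continuous_on A u" "continuous_on A v"
  shows "continuous_on A (order_rhs s g u v)"
  unfolding order_rhs_def by (intro continuous_intros assms)

text \<open>Strong induction is needed because \<open>v_seq\<close> uses \<open>THE\<close>: its
  value is known to be a solution, hence continuous, only once the problem of that order is uniquely
  solvable, and this rests on the continuity of the two preceding functions.\<close>

lemma continuous_on_v_seq: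
  assumes "0 \<le> L" "continuous_on {0..L} s" "continuous_on {0..L} g"
    and "continuous_on {0..L} v1" "continuous_on {0..L} v2"
  shows "continuous_on {0..L} (v_seq L s g v1 v2 n)"
proof (induction n rule: less_induct)
  case (less n)
  consider "n = 0" | "n = 1" | "n = 2" | m where "n = Suc (Suc (Suc m))"
    by (metis One_nat_def Suc_1 not0_implies_Suc)
  then show ?case
  proof cases
    case 4
    define f where "f = order_rhs s g (v_seq L s g v1 v2 (Suc m)) (v_seq L s g v1 v2 (Suc (Suc m)))"
    have "continuous_on {0..L} f"
      unfolding f_def using assms(2,3) less.IH 4 by (intro continuous_on_order_rhs) auto
    then have "(THE vw. vw \<in> bvp_solutions L f) \<in> bvp_solutions L f"
      by (rule theI'[OF bvp_solutions_ex1[OF assms(1)]])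
    moreover have "continuous_on {0..L} (fst vw)" if "vw \<in> bvp_solutions L f" for vw
      using that is_bvp_solution_continuous_on(1) by (auto simp: bvp_solutions_def)
    ultimately show ?thesis
      using 4 by (simp add: f_def)
  qed (use assms in \<open>auto simp: numeral_2_eq_2\<close>)
qed

theorem theorem3p3:
  fixes L G B :: real and p q s1 v1 w1 v2 w2 :: "real \<Rightarrow> real"
  assumes "0 < L" and "G\<^sup>2 + B\<^sup>2 \<noteq> 0"
    and "continuous_on {0..L} p" and "continuous_on {0..L} q"
    and "\<forall>x\<in>{0..L}. (s1 has_real_derivative (B * p x - G * q x) / (G\<^sup>2 + B\<^sup>2)) (at x within {0..L})"
    and "s1 L = 0"
    and "is_bvp_solution L (\<lambda>x. - load G B p q x) v1 w1"
    and "is_bvp_solution L (\<lambda>x. (s1 x)\<^sup>2 + load G B p q x * v1 x) v2 w2"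
  shows "\<forall>n\<ge>3. let v = v_seq L s1 (load G B p q) v1 v2;
                   S = bvp_solutions L (order_rhs s1 (load G B p q) (v (n - 2)) (v (n - 1)))
               in (\<exists>!vw. vw \<in> S) \<and> (\<forall>(vn, wn)\<in>S. C1_on_interval L vn \<and> C1_on_interval L wn)"
proof -
  let ?g = "load G B p q"
  let ?v = "v_seq L s1 ?g v1 v2"
  have s1: "continuous_on {0..L} s1"
    using DERIV_continuous_on[OF bspec[OF assms(5)]] .
  have g: "continuous_on {0..L} ?g"
    unfolding load_def by (intro continuous_intros assms(3,4) ballI assms(2))
  \<comment> \<open>\<open>v1\<close> and \<open>v2\<close> start the recursion: as solutions of
    their own problems they are continuous.\<close>
  have "continuous_on {0..L} (?v n)" for n
    using assms(1) s1 g assms(7,8)[THEN is_bvp_solution_continuous_on(1)]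
    by (intro continuous_on_v_seq) auto
  then have rhs: "continuous_on {0..L} (order_rhs s1 ?g (?v (n - 2)) (?v (n - 1)))" for n
    by (intro continuous_on_order_rhs s1 g)
  show ?thesis
    unfolding Let_def
  proof (intro allI impI conjI ballI)
    fix n
    let ?S = "bvp_solutions L (order_rhs s1 ?g (?v (n - 2)) (?v (n - 1)))"
    show "\<exists>!vw. vw \<in> ?S"
      using assms(1) by (intro bvp_solutions_ex1[OF _ rhs]) simp
    fix vw assume "vw \<in> ?S"
    then show "case vw of (vn, wn) \<Rightarrow> C1_on_interval L vn \<and> C1_on_interval L wn"
      using bvp_solutions_C1[OF rhs[of n], of "fst vw" "snd vw"] by (simp add: case_prod_beta)
  qed
qed

end
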